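(* Let $a,b,c\in\mathbb{Q}$ with $abc\neq0$, $2ac-b^2\neq 0$ and $4ac-b^2\neq 0$. Then the elliptic curve \[\mathcal{E}_2:\ Y^2=X^3-3a^4c^4X+a^4c^4(2a^2c^2-4ab^2c+b^4)\] over $\mathbb{Q}$ has positive rank. *)

theory Defs
  imports Complex_Main "HOL-Library.Extended_Nat" "HOL-Algebra.FiniteProduct"
begin

datatype 'a ec_point = Infinity | Affine 'a 'a

text \<open>Short Weierstrass curves $Y^2 = X^3 + A X + B$ over a field of characteristic $0$,
  given by their coefficients; the curve is elliptic when the discriminant does not vanish.\<close>

definition ec_discriminant :: "'a::field_char_0 \<Rightarrow> 'a \<Rightarrow> 'a" where
  "ec_discriminant A B = - 16 * (4 * A ^ 3 + 27 * B ^ 2)"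

definition is_elliptic_curve :: "'a::field_char_0 \<Rightarrow> 'a \<Rightarrow> bool" where
  "is_elliptic_curve A B \<longleftrightarrow> ec_discriminant A B \<noteq> 0"

definition ec_points :: "'a::field_char_0 \<Rightarrow> 'a \<Rightarrow> 'a ec_point set" where
  "ec_points A B = insert Infinity {Affine x y | x y. y ^ 2 = x ^ 3 + A * x + B}"

text \<open>Chord-tangent addition. It depends on \<open>B\<close> only through the points it is applied to.
  For points on the curve, reaching the tangent slope forces \<open>y\<^sub>1 = y\<^sub>2 \<noteq> 0\<close>.\<close>

fun ec_add :: "'a::field_char_0 \<Rightarrow> 'a ec_point \<Rightarrow> 'a ec_point \<Rightarrow> 'a ec_point" where
  "ec_add A Infinity Q = Q"
| "ec_add A (Affine x\<^sub>1 y\<^sub>1) Infinity = Affine x\<^sub>1 y\<^sub>1"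
| "ec_add A (Affine x\<^sub>1 y\<^sub>1) (Affine x\<^sub>2 y\<^sub>2) =
    (if x\<^sub>1 = x\<^sub>2 \<and> y\<^sub>1 = - y\<^sub>2 then Infinity
     else
       let m = (if x\<^sub>1 = x\<^sub>2 then (3 * x\<^sub>1 ^ 2 + A) / (2 * y\<^sub>1) else (y\<^sub>2 - y\<^sub>1) / (x\<^sub>2 - x\<^sub>1));
           x\<^sub>3 = m ^ 2 - x\<^sub>1 - x\<^sub>2
       in Affine x\<^sub>3 (m * (x\<^sub>1 - x\<^sub>3) - y\<^sub>1))"

text \<open>The Mordell--Weil group of the curve, in the multiplicative notation of the
  \<open>monoid\<close> record.\<close>

definition ec_group :: "'a::field_char_0 \<Rightarrow> 'a \<Rightarrow> 'a ec_point monoid" where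
  "ec_group A B = \<lparr>carrier = ec_points A B, mult = ec_add A, one = Infinity\<rparr>"

definition int_independent :: "('a, 'b) monoid_scheme \<Rightarrow> 'a set \<Rightarrow> bool" where
  "int_independent G S \<longleftrightarrow> finite S \<and> S \<subseteq> carrier G \<and>
     (\<forall>k :: 'a \<Rightarrow> int.
        finprod G (\<lambda>s. s [^]\<^bsub>G\<^esub> k s) S = \<one>\<^bsub>G\<^esub> \<longrightarrow> (\<forall>s\<in>S. k s = 0))"

text \<open>The rank of an abelian group is the supremum of the sizes of its finite
  \<open>\<int>\<close>-linearly independent subsets, i.e. the dimension of its tensor product with the
  rationals. For a finitely generated group it is the \<open>r\<close> in a decomposition
  \<open>\<int>\<^sup>r \<times> T\<close> with \<open>T\<close> finite.\<close>

definition abelian_rank :: "('a, 'b) monoid_scheme \<Rightarrow> enat" where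
  "abelian_rank G = (SUP S \<in> {S. int_independent G S}. enat (card S))"

definition ec_rank :: "rat \<Rightarrow> rat \<Rightarrow> enat" where
  "ec_rank A B = abelian_rank (ec_group A B)"

end

theory Submission
  imports Defs
begin

text \<open>Put \<open>s = b\<^sup>2/(ac) - 2\<close>. Scaling by powers of \<open>ac\<close> turns the curve into
  \<open>y\<^sup>2 = x\<^sup>3 - 3x + s\<^sup>2 - 2\<close>, which contains \<open>Q = (-1, s)\<close>. At the prime 2, doubling a point
  with \<open>x\<close> sufficiently large multiplies \<open>x\<close> by an odd unit divided by 4, so such a point has
  pairwise different multiples by the powers of 2. This is impossible for a point of finite order,
  whose sequence of multiples is periodic. One of \<open>3Q\<close>, \<open>4Q\<close>, \<open>5Q\<close> is that large, according
  to the power of 2 in the denominator of \<open>s\<close>. The full associativity of the group law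
  is not needed: \<open>(R + P) + P = R + 2P\<close> gives \<open>(2n)P = n(2P)\<close>, and that suffices.\<close>

section \<open>Chord-tangent addition\<close>

declare ec_add.simps(3) [simp del]

text \<open>Substituting the line of slope \<open>m\<close> through the first point into the cubic
  leaves, besides the root \<open>x\<^sub>1\<close>, a quadratic; the second assumption says that
  \<open>x\<^sub>2\<close> is a root of it. By Vieta the third root is \<open>x\<^sub>3\<close>. For
  \<open>x\<^sub>1 = x\<^sub>2\<close> the assumption becomes the tangent condition, so chord and
  tangent are treated together.\<close>

lemma third_point_on_curve:
  fixes A B :: "'a::field_char_0"
  assumes "y\<^sub>1 ^ 2 = x\<^sub>1 ^ 3 + A * x\<^sub>1 + B"
    and "m ^ 2 * (x\<^sub>2 - x\<^sub>1) + 2 * y\<^sub>1 * m = x\<^sub>1 ^ 2 + x\<^sub>1 * x\<^sub>2 + x\<^sub>2 ^ 2 + A"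
    and "x\<^sub>3 = m ^ 2 - x\<^sub>1 - x\<^sub>2"
  shows "(m * (x\<^sub>1 - x\<^sub>3) - y\<^sub>1) ^ 2 = x\<^sub>3 ^ 3 + A * x\<^sub>3 + B"
  using assms by algebra

text \<open>Subtract the two curve equations and cancel
  \<open>x\<^sub>2 - x\<^sub>1\<close>.\<close>

lemma chord_slope:
  fixes A B :: "'a::field_char_0"
  assumes "y\<^sub>1 ^ 2 = x\<^sub>1 ^ 3 + A * x\<^sub>1 + B" "y\<^sub>2 ^ 2 = x\<^sub>2 ^ 3 + A * x\<^sub>2 + B"
    and "x\<^sub>1 \<noteq> x\<^sub>2" and m: "y\<^sub>2 = y\<^sub>1 + m * (x\<^sub>2 - x\<^sub>1)"
  shows "m ^ 2 * (x\<^sub>2 - x\<^sub>1) + 2 * y\<^sub>1 * m = x\<^sub>1 ^ 2 + x\<^sub>1 * x\<^sub>2 + x\<^sub>2 ^ 2 + A"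
proof -
  have "(x\<^sub>2 - x\<^sub>1) * (m ^ 2 * (x\<^sub>2 - x\<^sub>1) + 2 * y\<^sub>1 * m)
      = (x\<^sub>2 - x\<^sub>1) * (x\<^sub>1 ^ 2 + x\<^sub>1 * x\<^sub>2 + x\<^sub>2 ^ 2 + A)"
    using assms(1,2) unfolding m by algebra
  with \<open>x\<^sub>1 \<noteq> x\<^sub>2\<close> show ?thesis
    by simp
qed

text \<open>The slope enters through a product equation instead of a quotient, which keeps later
  identities polynomial and within reach of \<open>algebra\<close>.\<close>

lemma ec_add_chord:
  assumes "x\<^sub>1 \<noteq> x\<^sub>2" "y\<^sub>2 = y\<^sub>1 + m * (x\<^sub>2 - x\<^sub>1)"
  shows "ec_add A (Affine x\<^sub>1 y\<^sub>1) (Affine x\<^sub>2 y\<^sub>2) =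
    Affine (m ^ 2 - x\<^sub>1 - x\<^sub>2) (m * (x\<^sub>1 - (m ^ 2 - x\<^sub>1 - x\<^sub>2)) - y\<^sub>1)"
  using assms by (simp add: ec_add.simps(3) Let_def)

lemma ec_add_tangent:
  fixes A :: "'a::field_char_0"
  assumes "y \<noteq> 0" "2 * y * m = 3 * x ^ 2 + A"
  shows "ec_add A (Affine x y) (Affine x y) =
    Affine (m ^ 2 - 2 * x) (m * (x - (m ^ 2 - 2 * x)) - y)"
proof -
  have "(3 * x ^ 2 + A) / (2 * y) = m"
    using assms by (simp add: field_simps)
  with \<open>y \<noteq> 0\<close> show ?thesis
    by (simp add: ec_add.simps(3) Let_def)
qed

lemma ec_add_uminus [simp]:
  "ec_add A (Affine x y) (Affine x (- y)) = Infinity"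
  "ec_add A (Affine x (- y)) (Affine x y) = Infinity"
  by (simp_all add: ec_add.simps(3))

lemma Affine_in_ec_points: "Affine x y \<in> ec_points A B \<longleftrightarrow> y ^ 2 = x ^ 3 + A * x + B"
  by (auto simp: ec_points_def)

lemma ec_points_same_x:
  fixes A B :: "'a::field_char_0"
  assumes "Affine x y \<in> ec_points A B" "Affine x z \<in> ec_points A B" "z \<noteq> - y"
  shows "z = y"
proof -
  have "(z - y) * (z + y) = 0"
    using assms(1,2) unfolding Affine_in_ec_points by algebra
  with \<open>z \<noteq> - y\<close> show ?thesis
    by (simp add: add_eq_0_iff2)
qed

lemma ec_add_closed:
  fixes A B :: "'a::field_char_0"
  assumes P: "P \<in> ec_points A B" and Q: "Q \<in> ec_points A B"
  shows "ec_add A P Q \<in> ec_points A B"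
proof (cases P)
  case P_aff: (Affine x\<^sub>1 y\<^sub>1)
  show ?thesis
  proof (cases Q)
    case Q_aff: (Affine x\<^sub>2 y\<^sub>2)
    have c1: "y\<^sub>1 ^ 2 = x\<^sub>1 ^ 3 + A * x\<^sub>1 + B" and c2: "y\<^sub>2 ^ 2 = x\<^sub>2 ^ 3 + A * x\<^sub>2 + B"
      using P Q unfolding P_aff Q_aff Affine_in_ec_points by auto
    consider "x\<^sub>1 \<noteq> x\<^sub>2" | "x\<^sub>2 = x\<^sub>1" "y\<^sub>2 = - y\<^sub>1" | "x\<^sub>2 = x\<^sub>1" "y\<^sub>2 \<noteq> - y\<^sub>1"
      by auto
    then show ?thesis
    proof cases
      case 1
      define m where "m = (y\<^sub>2 - y\<^sub>1) / (x\<^sub>2 - x\<^sub>1)"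
      have y2: "y\<^sub>2 = y\<^sub>1 + m * (x\<^sub>2 - x\<^sub>1)"
        using 1 by (simp add: m_def)
      show ?thesis
        unfolding P_aff Q_aff ec_add_chord[OF 1 y2] Affine_in_ec_points
        by (rule third_point_on_curve[OF c1 chord_slope[OF c1 c2 1 y2] refl])
    next
      case 2
      then show ?thesis
        by (simp add: P_aff Q_aff ec_points_def)
    next
      case 3
      have y2: "y\<^sub>2 = y\<^sub>1"
        by (rule ec_points_same_x[of x\<^sub>1 _ A B])
          (use P Q 3 in \<open>auto simp: P_aff Q_aff\<close>)
      with 3 have "y\<^sub>1 \<noteq> 0"
        by auto
      define m where "m = (3 * x\<^sub>1 ^ 2 + A) / (2 * y\<^sub>1)"
      have m: "2 * y\<^sub>1 * m = 3 * x\<^sub>1 ^ 2 + A"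
        using \<open>y\<^sub>1 \<noteq> 0\<close> by (simp add: m_def)
      then have "m ^ 2 * (x\<^sub>1 - x\<^sub>1) + 2 * y\<^sub>1 * m = x\<^sub>1 ^ 2 + x\<^sub>1 * x\<^sub>1 + x\<^sub>1 ^ 2 + A"
        by (simp add: power2_eq_square)
      from third_point_on_curve[OF c1 this refl] show ?thesis
        unfolding P_aff Q_aff \<open>x\<^sub>2 = x\<^sub>1\<close> y2 ec_add_tangent[OF \<open>y\<^sub>1 \<noteq> 0\<close> m] Affine_in_ec_points
        by (simp add: algebra_simps)
    qed
  qed (use P P_aff in simp)
qed (use Q in simp)

lemma ec_add_commute:
  fixes A B :: "'a::field_char_0"
  assumes P: "P \<in> ec_points A B" and Q: "Q \<in> ec_points A B"
  shows "ec_add A P Q = ec_add A Q P"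
proof (cases P)
  case P_aff: (Affine x\<^sub>1 y\<^sub>1)
  show ?thesis
  proof (cases Q)
    case Q_aff: (Affine x\<^sub>2 y\<^sub>2)
    show ?thesis
    proof (cases "x\<^sub>1 = x\<^sub>2")
      case True
      show ?thesis
      proof (cases "y\<^sub>2 = - y\<^sub>1")
        case False
        then have "y\<^sub>2 = y\<^sub>1"
          using ec_points_same_x[of x\<^sub>1 y\<^sub>1 A B y\<^sub>2] P Q True by (simp add: P_aff Q_aff)
        with True show ?thesis
          by (simp add: P_aff Q_aff)
      qed (simp add: P_aff Q_aff True)
    next
      case False
      define m where "m = (y\<^sub>2 - y\<^sub>1) / (x\<^sub>2 - x\<^sub>1)"
      have y2: "y\<^sub>2 = y\<^sub>1 + m * (x\<^sub>2 - x\<^sub>1)" and y1: "y\<^sub>1 = y\<^sub>2 + m * (x\<^sub>1 - x\<^sub>2)"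
        using False by (simp_all add: m_def divide_simps) (simp add: algebra_simps)
      show ?thesis
        unfolding P_aff Q_aff ec_add_chord[OF False y2] ec_add_chord[OF False[symmetric] y1]
        using y2 by (simp add: algebra_simps)
    qed
  next
    case Infinity
    then show ?thesis by (simp add: P_aff)
  qed
next
  case Infinity
  then show ?thesis by (cases Q) auto
qed

text \<open>The only instance of associativity that the argument needs. If \<open>t\<close> is the slope of the
  tangent at \<open>P = (a, b)\<close> and \<open>l\<close> that of the chord from \<open>R = (x, y)\<close> to \<open>P\<close>, then, with
  \<open>q = (x - a) / (l - t)\<close>, the second chord on the left has slope \<open>q - l\<close> and the one on the right
  has slope \<open>q - t\<close>.\<close>

lemma ec_add_add_same:
  fixes A B :: "'a::field_char_0"
  assumes R: "R \<in> ec_points A B" and P: "Affine a b \<in> ec_points A B" and b: "b \<noteq> 0"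
  shows "ec_add A (ec_add A R (Affine a b)) (Affine a b) =
    ec_add A R (ec_add A (Affine a b) (Affine a b))"
proof (cases R)
  case R_aff: (Affine x y)
  have cP: "b ^ 2 = a ^ 3 + A * a + B" and cR: "y ^ 2 = x ^ 3 + A * x + B"
    using P R unfolding R_aff Affine_in_ec_points by auto
  define t where "t = (3 * a ^ 2 + A) / (2 * b)"
  have t: "2 * b * t = 3 * a ^ 2 + A"
    using b by (simp add: t_def)
  define d where "d = t ^ 2 - 2 * a"
  define e where "e = t * (a - d) - b"
  have PP: "ec_add A (Affine a b) (Affine a b) = Affine d e"
    using ec_add_tangent[OF b t] by (simp add: d_def e_def)
  have cD: "Affine d e \<in> ec_points A B"
    using ec_add_closed[OF P P] unfolding PP .
  consider "x = a" "y = b" | "x = a" "y = - b" | "x \<noteq> a"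
    using ec_points_same_x[OF P, of y] R R_aff by auto
  then show ?thesis
  proof cases
    case 1
    then show ?thesis
      using ec_add_commute[OF cD P] by (simp add: PP R_aff)
  next
    case 2
    have "ec_add A (Affine a (- b)) (Affine d e) = Affine a b"
    \<comment> \<open>If \<open>d = a\<close>, then 2P = -P, and the sum is the doubling of -P,
      whose tangent has slope \<open>- t\<close>.\<close>
    proof (cases "d = a")
      case True
      have t': "2 * (- b) * (- t) = 3 * a ^ 2 + A"
        using t by simp
      have "- b \<noteq> 0" using b by simp
      have e: "e = - b"
        by (simp add: e_def True)
      show ?thesis
        unfolding True e ec_add_tangent[OF \<open>- b \<noteq> 0\<close> t']
        using True by (simp add: d_def)
    next
      case False
      have "e = - b + (- t) * (d - a)"
        by (simp add: e_def algebra_simps)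
      from ec_add_chord[OF False[symmetric] this] show ?thesis
        by (simp add: d_def)
    qed
    with 2 show ?thesis
      by (simp add: R_aff PP)
  next
    case 3
    define l where "l = (b - y) / (a - x)"
    define h where "h = x - a"
    define k where "k = l - t"
    define u where "u = l ^ 2 - x - a"
    define w where "w = l * (x - u) - y"
    define g where "g = u - a"
    have h: "h \<noteq> 0"
      using 3 by (simp add: h_def)
    have bl: "b = y + l * (a - x)" and yl: "y = b + l * (x - a)"
      using 3 by (simp_all add: l_def divide_simps) (simp add: algebra_simps)
    have w': "w = l * (a - u) - b"
      unfolding w_def bl by (simp add: algebra_simps)
    have RP: "ec_add A R (Affine a b) = Affine u w"
      unfolding R_aff ec_add_chord[OF 3 bl] by (simp add: u_def w_def)
    have "l ^ 2 * (x - a) + 2 * b * l = a ^ 2 + a * x + x ^ 2 + A"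
      using chord_slope[OF cP cR 3[symmetric] yl] .
    \<comment> \<open>Difference of the chord equation and the tangent equation at P, with
      \<open>h\<close> factored out.\<close>
    then have key: "2 * b * k = - (h * g)"
      using t unfolding k_def h_def g_def u_def by algebra
    show ?thesis
    proof (cases "k = 0")
      case True
      \<comment> \<open>Here the chord from R to P is the tangent at P, so R = -2P and both sides
        are \<open>Infinity\<close>.\<close>
      with key h have "u = a"
        by (simp add: g_def)
      have xd: "x = d"
        using True \<open>u = a\<close> by (simp add: k_def d_def u_def algebra_simps)
      have "y = - e"
        unfolding yl e_def using True xd by (simp add: k_def algebra_simps)
      then show ?thesis
        unfolding RP PP unfolding R_aff w' \<open>u = a\<close> \<open>y = - e\<close> xd by simp
    next
      case False
      have "g \<noteq> 0"
        using key False b by auto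
      then have ua: "u \<noteq> a"
        by (simp add: g_def)
      define q where "q = h / k"
      have q: "q * k = h"
        using False by (simp add: q_def)
      have "k * (2 * b + q * g) = 0"
        using key q by algebra
      then have bq: "2 * b = - (q * g)"
        using False by (simp add: add_eq_0_iff2)
      have "b = w + (q - l) * (a - u)"
        using bq unfolding w' g_def by algebra
      note S = ec_add_chord[OF ua this]
      have lsq: "l ^ 2 = g + h + 3 * a"
        by (simp add: g_def u_def h_def)
      have xd: "x - d = k * (l + t) - g"
        unfolding d_def k_def g_def u_def by algebra
      have ye: "y - e = (q - t) * (x - d)"
        using bq q xd unfolding yl e_def h_def by algebra
      have eq1: "(q - l) ^ 2 - u - a = (q - t) ^ 2 - x - d"
        using q unfolding h_def k_def u_def d_def by algebra
      have eq2: "(q - l) * (u - X) - w = (q - t) * (x - X) - y"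
        if X: "X = (q - t) ^ 2 - x - d" for X
        using bq q X xd unfolding w' yl h_def k_def u_def d_def g_def by algebra
      have "ec_add A (Affine x y) (Affine d e) =
          Affine ((q - t) ^ 2 - x - d) ((q - t) * (x - ((q - t) ^ 2 - x - d)) - y)"
      proof (cases "x = d")
        case False
        then show ?thesis
          by (rule ec_add_chord) (use ye in algebra)
      next
        case True
        \<comment> \<open>Now R = 2P, so the right-hand sum is a doubling; its tangent must be shown
          to have the slope \<open>q - t\<close> of the generic case.\<close>
        then have y: "y = e"
          using ye by simp
        have g: "g = k * (l + t)"
          using xd True by simp
        have "k * (2 * y) = k * (h * k)"
          using key g unfolding yl h_def[symmetric] k_def by algebra
        then have y': "2 * y = h * k"
          using False by simp
        then have "y \<noteq> 0"
          using h False by auto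
        have slope: "2 * y * (q - t) = 3 * x ^ 2 + A"
        proof -
          have "A = - (h * (l + t) * t) - 3 * a ^ 2"
            using t bq q g by algebra
          moreover have "l ^ 2 = k * (l + t) + h + 3 * a"
            using lsq g by simp
          ultimately show ?thesis
            using y' q unfolding h_def k_def by algebra
        qed
        have "ec_add A (Affine x y) (Affine x y) =
            Affine ((q - t) ^ 2 - 2 * x) ((q - t) * (x - ((q - t) ^ 2 - 2 * x)) - y)"
          by (rule ec_add_tangent[OF \<open>y \<noteq> 0\<close> slope])
        then show ?thesis
          using True y by (simp add: algebra_simps)
      qed
      then show ?thesis
        unfolding RP PP S unfolding R_aff using eq1 eq2 by simp
    qed
  qed
qed simp

section \<open>Rank and elements of infinite order\<close>

lemma ec_group_simps [simp]:
  "carrier (ec_group A B) = ec_points A B"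
  "x \<otimes>\<^bsub>ec_group A B\<^esub> y = ec_add A x y"
  "\<one>\<^bsub>ec_group A B\<^esub> = Infinity"
  by (simp_all add: ec_group_def)

lemma Infinity_in_ec_points [simp]: "Infinity \<in> ec_points A B"
  by (simp add: ec_points_def)

lemma ec_add_Infinity_right [simp]: "ec_add A P Infinity = P"
  by (cases P) auto

lemma ec_add_eq_Infinity_iff:
  "ec_add A (Affine x y) Q = Infinity \<longleftrightarrow> Q = Affine x (- y)"
  by (cases Q) (auto simp: ec_add.simps(3) Let_def)

lemma ec_pow_closed:
  fixes A B :: "'a::field_char_0"
  assumes "P \<in> ec_points A B"
  shows "P [^]\<^bsub>ec_group A B\<^esub> (n::nat) \<in> ec_points A B"
  using assms by (induction n) (auto intro: ec_add_closed)

text \<open>\<open>m_inv\<close> is a definite description, so uniqueness matters: only one second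
  summand brings an affine point to \<open>Infinity\<close>.\<close>

lemma ec_inv_Affine:
  assumes "Affine x y \<in> ec_points A B"
  shows "inv\<^bsub>ec_group A B\<^esub> (Affine x y) = Affine x (- y)"
  unfolding m_inv_def
  by (rule the_equality)
    (use assms in \<open>auto simp: Affine_in_ec_points ec_add_eq_Infinity_iff\<close>)

text \<open>Read off from the fold relation itself: associativity of \<open>ec_add\<close> is proved
  only in one special case, so \<open>ec_group\<close> is not at hand as a
  \<open>comm_monoid\<close>.\<close>

lemma finprod_singleton_closed:
  assumes "f a \<otimes>\<^bsub>G\<^esub> \<one>\<^bsub>G\<^esub> \<in> carrier G" "\<one>\<^bsub>G\<^esub> \<in> carrier G"
  shows "finprod G f {a} = f a \<otimes>\<^bsub>G\<^esub> \<one>\<^bsub>G\<^esub>"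
proof -
  have "foldD (carrier G) (mult G \<circ> f) \<one>\<^bsub>G\<^esub> {a} = f a \<otimes>\<^bsub>G\<^esub> \<one>\<^bsub>G\<^esub>"
    unfolding foldD_def
  proof (rule the_equality)
    show "({a}, f a \<otimes>\<^bsub>G\<^esub> \<one>\<^bsub>G\<^esub>) \<in> foldSetD (carrier G) (mult G \<circ> f) \<one>\<^bsub>G\<^esub>"
      using foldSetD.insertI[of a "{}" "mult G \<circ> f" "\<one>\<^bsub>G\<^esub>" "carrier G" "\<one>\<^bsub>G\<^esub>"] assms
      by (auto intro: foldSetD.emptyI)
  next
    fix x
    assume "({a}, x) \<in> foldSetD (carrier G) (mult G \<circ> f) \<one>\<^bsub>G\<^esub>"
    from foldSetD_backwards[OF _ this] show "x = f a \<otimes>\<^bsub>G\<^esub> \<one>\<^bsub>G\<^esub>"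
      by (auto elim: empty_foldSetDE)
  qed
  then show ?thesis
    by (simp add: finprod_def)
qed

lemma ec_group_rank_pos:
  fixes A B :: "'a::field_char_0"
  assumes P: "P \<in> ec_points A B"
    and inf: "\<And>n::nat. n > 0 \<Longrightarrow> P [^]\<^bsub>ec_group A B\<^esub> n \<noteq> Infinity"
  shows "abelian_rank (ec_group A B) > 0"
proof -
  let ?G = "ec_group A B"
  have pow: "P [^]\<^bsub>?G\<^esub> i \<in> ec_points A B \<and> (P [^]\<^bsub>?G\<^esub> i = Infinity \<longrightarrow> i = 0)" for i :: int
  proof (cases i rule: int_cases)
    case (nonneg n)
    then show ?thesis
      using ec_pow_closed[OF P, of n] inf[of n] by (auto simp: int_pow_int)
  next
    case (neg n)
    \<comment> \<open>A negative exponent gives the inverse of a positive power, which is the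
      reflection of an affine point and hence affine.\<close>
    have *: "P [^]\<^bsub>?G\<^esub> Suc n \<in> ec_points A B" "P [^]\<^bsub>?G\<^esub> Suc n \<noteq> Infinity"
      by (rule ec_pow_closed[OF P], rule inf) simp
    then obtain x y where xy: "P [^]\<^bsub>?G\<^esub> Suc n = Affine x y"
      by (cases "P [^]\<^bsub>?G\<^esub> Suc n") auto
    have "P [^]\<^bsub>?G\<^esub> i = inv\<^bsub>?G\<^esub> (P [^]\<^bsub>?G\<^esub> Suc n)"
      unfolding neg int_pow_def2 by (simp del: of_nat_Suc nat_pow_Suc)
    also have "\<dots> = Affine x (- y)"
      using * ec_inv_Affine unfolding xy by blast
    finally show ?thesis
      using * unfolding xy by (simp add: Affine_in_ec_points)
  qed
  have "int_independent ?G {P}"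
    using P pow by (auto simp: int_independent_def finprod_singleton_closed)
  then have "enat (card {P}) \<le> abelian_rank ?G"
    unfolding abelian_rank_def by (intro SUP_upper) simp
  then show ?thesis
    by (simp add: zero_enat_def one_enat_def less_le_trans[rotated])
qed

text \<open>Powers multiply by the base on the right, which is the shape of
  \<open>ec_add_add_same\<close> with the power \<open>2 * n\<close> as R.\<close>

lemma ec_pow_double:
  fixes A B :: "'a::field_char_0"
  assumes P: "Affine x y \<in> ec_points A B" and "y \<noteq> 0"
  shows "Affine x y [^]\<^bsub>ec_group A B\<^esub> (2 * n :: nat) =
    ec_add A (Affine x y) (Affine x y) [^]\<^bsub>ec_group A B\<^esub> n"
proof (induction n)
  case (Suc n)
  have "ec_add A (ec_add A (Affine x y [^]\<^bsub>ec_group A B\<^esub> (2 * n)) (Affine x y)) (Affine x y) =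
      ec_add A (Affine x y [^]\<^bsub>ec_group A B\<^esub> (2 * n)) (ec_add A (Affine x y) (Affine x y))"
    by (rule ec_add_add_same[OF ec_pow_closed[OF P] assms])
  with Suc show ?case
    by simp
qed simp

text \<open>Each power arises from the preceding one by adding \<open>P\<close>, so the sequence
  starts over once it is back at \<open>Infinity\<close>.\<close>

lemma ec_pow_mod:
  fixes n i :: nat
  assumes "P [^]\<^bsub>ec_group A B\<^esub> n = Infinity"
  shows "P [^]\<^bsub>ec_group A B\<^esub> (i mod n) = P [^]\<^bsub>ec_group A B\<^esub> i"
proof -
  have shift: "P [^]\<^bsub>ec_group A B\<^esub> (n + j) = P [^]\<^bsub>ec_group A B\<^esub> j" for j :: nat
    by (induction j) (simp_all add: assms)
  have "P [^]\<^bsub>ec_group A B\<^esub> (n * k + j) = P [^]\<^bsub>ec_group A B\<^esub> j" for j k :: nat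
    by (induction k) (simp_all add: shift add.assoc)
  from this[of "i div n" "i mod n"] show ?thesis
    by simp
qed

section \<open>The rationals that are integral at 2\<close>

text \<open>The localization of the integers at the prime 2.\<close>

definition Z2 :: "rat set" where
  "Z2 = {of_int m / of_int n | m n. odd n}"

text \<open>The units of \<open>Z2\<close>: the residue field has two elements, so being a unit
  means being 1 modulo 2.\<close>

definition odd_Z2 :: "rat set" where
  "odd_Z2 = {1 + 2 * r | r. r \<in> Z2}"

lemma Z2I: "odd n \<Longrightarrow> of_int m / of_int n \<in> Z2"
  by (auto simp: Z2_def)

lemma of_int_Z2: "of_int m \<in> Z2"
  using Z2I[of 1 m] by simp

lemma numeral_Z2 [simp]: "numeral k \<in> Z2" "0 \<in> Z2" "1 \<in> Z2"
  using of_int_Z2[of "numeral k"] of_int_Z2[of 0] of_int_Z2[of 1] by simp_all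

lemma Z2_mult: assumes "x \<in> Z2" "y \<in> Z2" shows "x * y \<in> Z2"
proof -
  from assms obtain m n m' n' where
    "x = of_int m / of_int n" "y = of_int m' / of_int n'" "odd n" "odd n'"
    by (auto simp: Z2_def)
  then show ?thesis
    using Z2I[of "n * n'" "m * m'"] by simp
qed

lemma Z2_add: assumes "x \<in> Z2" "y \<in> Z2" shows "x + y \<in> Z2"
proof -
  from assms obtain m n m' n' where
    *: "x = of_int m / of_int n" "y = of_int m' / of_int n'" "odd n" "odd n'"
    by (auto simp: Z2_def)
  then have "n \<noteq> 0" "n' \<noteq> 0"
    by auto
  with * show ?thesis
    using Z2I[of "n * n'" "m * n' + m' * n"] by (simp add: add_frac_eq)
qed

lemma Z2_uminus: "x \<in> Z2 \<Longrightarrow> - x \<in> Z2"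
  using Z2_mult[OF of_int_Z2[of "- 1"]] by simp

lemma Z2_diff: "x \<in> Z2 \<Longrightarrow> y \<in> Z2 \<Longrightarrow> x - y \<in> Z2"
  using Z2_add[OF _ Z2_uminus] by simp

lemma Z2_power: "x \<in> Z2 \<Longrightarrow> x ^ n \<in> Z2"
  by (induction n) (auto intro: Z2_mult)

lemmas Z2_intros = Z2_mult Z2_add Z2_uminus Z2_diff Z2_power numeral_Z2

lemma half_notin_Z2: "1 / 2 \<notin> Z2"
proof
  assume "1 / 2 \<in> Z2"
  then obtain m n where "1 / 2 = (of_int m / of_int n :: rat)" "odd n"
    by (auto simp: Z2_def)
  moreover from this have "n \<noteq> 0"
    by auto
  ultimately have "(of_int n :: rat) = of_int (2 * m)"
    by (simp add: field_simps)
  with \<open>odd n\<close> show False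
    by (simp only: of_int_eq_iff) simp
qed

lemma odd_Z2I: "r \<in> Z2 \<Longrightarrow> x = 1 + 2 * r \<Longrightarrow> x \<in> odd_Z2"
  by (auto simp: odd_Z2_def)

lemma odd_Z2_imp_Z2: "x \<in> odd_Z2 \<Longrightarrow> x \<in> Z2"
  by (auto simp: odd_Z2_def intro!: Z2_intros)

text \<open>Parity in \<open>Z2\<close>, used in place of a valuation: otherwise
  \<open>1 / 2\<close> would be a difference of elements of \<open>Z2\<close>.\<close>

lemma odd_Z2_not_double: assumes "x \<in> odd_Z2" "r \<in> Z2" shows "x \<noteq> 2 * r"
proof
  assume "x = 2 * r"
  moreover obtain q where "q \<in> Z2" "x = 1 + 2 * q"
    using assms by (auto simp: odd_Z2_def)
  ultimately have "1 / 2 = r - q" "r - q \<in> Z2"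
    using assms(2) Z2_diff by simp_all
  with half_notin_Z2 show False
    by metis
qed

lemma odd_Z2_nonzero: "x \<in> odd_Z2 \<Longrightarrow> x \<noteq> 0"
  using odd_Z2_not_double[of x 0] by simp

lemma odd_Z2_quotient:
  assumes "odd m" "odd n"
  shows "of_int m / of_int n \<in> odd_Z2"
proof -
  have "even (m - n)"
    using assms by simp
  then obtain k where "m - n = 2 * k"
    by (elim evenE)
  then have k: "m = n + 2 * k"
    by simp
  have "n \<noteq> 0" using assms by auto
  then show ?thesis
    using Z2I[OF assms(2), of k] by (auto intro!: odd_Z2I simp: k field_simps)
qed

lemma odd_Z2_inverse: assumes "x \<in> odd_Z2" shows "inverse x \<in> odd_Z2"
proof -
  obtain r where "r \<in> Z2" and x: "x = 1 + 2 * r"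
    using assms by (auto simp: odd_Z2_def)
  then obtain m n where "odd n" and r: "r = of_int m / of_int n"
    by (auto simp: Z2_def)
  then have "n \<noteq> 0"
    by auto
  then have "x = of_int (n + 2 * m) / of_int n"
    by (simp add: x r add_divide_distrib)
  then have "inverse x = of_int n / of_int (n + 2 * m)"
    by simp
  with \<open>odd n\<close> show ?thesis
    using odd_Z2_quotient[of n "n + 2 * m"] by simp
qed

lemma odd_Z2_mult: assumes "x \<in> odd_Z2" "y \<in> odd_Z2" shows "x * y \<in> odd_Z2"
proof -
  obtain q r where "q \<in> Z2" "x = 1 + 2 * q" "r \<in> Z2" "y = 1 + 2 * r"
    using assms by (auto simp: odd_Z2_def)
  then show ?thesis
    by (intro odd_Z2I[of "q + r + 2 * q * r"] Z2_intros) (auto simp: algebra_simps)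
qed

section \<open>Doubling near the point at infinity\<close>

text \<open>Chosen so that \<open>x\<^sup>3\<close> dominates \<open>A x\<close> and \<open>B\<close> 2-adically, and invariant under
  \<open>(x, A, B) \<mapsto> (u\<^sup>2 x, u\<^sup>4 A, u\<^sup>6 B)\<close>. The curve need not be integral at 2.\<close>

definition near_Infinity :: "rat \<Rightarrow> rat \<Rightarrow> rat \<Rightarrow> bool" where
  "near_Infinity A B x \<longleftrightarrow> x \<noteq> 0 \<and> A / x ^ 2 / 2 \<in> Z2 \<and> B / x ^ 3 / 2 \<in> Z2"

text \<open>With \<open>y ^ 2 = x ^ 3 * v\<close>, the duplication formula becomes
  \<open>4 * x' = x * w / v\<close>, where \<open>v\<close> and \<open>w\<close> are both
  units.\<close>

lemma ec_double_near_Infinity: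
  assumes P: "Affine x y \<in> ec_points A B" and near: "near_Infinity A B x"
  shows "y \<noteq> 0"
    and "\<exists>x' y' r. ec_add A (Affine x y) (Affine x y) = Affine x' y' \<and>
      near_Infinity A B x' \<and> r \<in> odd_Z2 \<and> 4 * x' = x * r"
proof -
  define \<alpha> where "\<alpha> = A / x ^ 2 / 2"
  define \<beta> where "\<beta> = B / x ^ 3 / 2"
  have x: "x \<noteq> 0" and \<alpha>: "\<alpha> \<in> Z2" and \<beta>: "\<beta> \<in> Z2"
    using near by (auto simp: near_Infinity_def \<alpha>_def \<beta>_def)
  have A: "A = 2 * \<alpha> * x ^ 2" and B: "B = 2 * \<beta> * x ^ 3"
    using x by (simp_all add: \<alpha>_def \<beta>_def)
  define v where "v = 1 + 2 * (\<alpha> + \<beta>)"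
  have v: "v \<in> odd_Z2"
    unfolding v_def by (rule odd_Z2I[OF _ refl]) (intro Z2_intros \<alpha> \<beta>)
  have y2: "y ^ 2 = x ^ 3 * v"
    using P unfolding Affine_in_ec_points v_def A B by algebra
  then show y: "y \<noteq> 0"
    using x odd_Z2_nonzero[OF v] by auto
  define m where "m = (3 * x ^ 2 + A) / (2 * y)"
  have m: "2 * y * m = 3 * x ^ 2 + A"
    using y by (simp add: m_def)
  \<comment> \<open>This is \<open>(3 + 2 * \<alpha>) ^ 2 - 8 * v\<close>, the numerator of the
    duplication formula divided by \<open>x ^ 4\<close>.\<close>
  define w where "w = 1 + 2 * (2 * \<alpha> ^ 2 - 2 * \<alpha> - 8 * \<beta>)"
  have w: "w \<in> odd_Z2"
    unfolding w_def by (rule odd_Z2I[OF _ refl]) (intro Z2_intros \<alpha> \<beta>)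
  define r where "r = w * inverse v"
  have r: "r \<in> odd_Z2"
    unfolding r_def by (intro odd_Z2_mult odd_Z2_inverse v w)
  have rv: "r * v = w"
    using odd_Z2_nonzero[OF v] by (simp add: r_def)
  define x' where "x' = m ^ 2 - 2 * x"
  have "x ^ 3 * v * (4 * x') = x ^ 3 * v * (x * r)"
  proof -
    have "4 * y ^ 2 * x' = x ^ 4 * w"
      using m y2 unfolding x'_def w_def v_def A by algebra
    then show ?thesis
      using y2 rv by algebra
  qed
  then have x': "4 * x' = x * r"
    using x odd_Z2_nonzero[OF v] by simp
  have r0: "r \<noteq> 0"
    by (rule odd_Z2_nonzero[OF r])
  then have x'0: "x' \<noteq> 0"
    using x x' by auto
  have x'': "x' = x * r / 4"
    using x' by simp
  \<comment> \<open>Doubling multiplies \<alpha> by 16 and \<beta> by 64, up to units, so nearness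
    persists.\<close>
  have A': "A / x' ^ 2 / 2 = 16 * \<alpha> * inverse r ^ 2"
    unfolding x'' A using x r0 by (simp add: field_simps)
  have B': "B / x' ^ 3 / 2 = 64 * \<beta> * inverse r ^ 3"
    unfolding x'' B using x r0 by (simp add: field_simps)
  have "near_Infinity A B x'"
    unfolding near_Infinity_def A' B'
    by (intro conjI x'0 Z2_intros \<alpha> \<beta> odd_Z2_imp_Z2[OF odd_Z2_inverse[OF r]])
  then show "\<exists>x' y' r. ec_add A (Affine x y) (Affine x y) = Affine x' y' \<and>
      near_Infinity A B x' \<and> r \<in> odd_Z2 \<and> 4 * x' = x * r"
    using ec_add_tangent[OF y m] r x' unfolding x'_def by blast
qed

text \<open>Induction with the point generalized: by \<open>ec_pow_double\<close> the multiple by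
  \<open>2 ^ Suc k\<close> is the multiple by \<open>2 ^ k\<close> of the doubled point, and the
  unit factors multiply.\<close>

lemma ec_pow_two_power_near_Infinity:
  assumes "Affine x y \<in> ec_points A B" "near_Infinity A B x"
  shows "\<exists>x' y' r. Affine x y [^]\<^bsub>ec_group A B\<^esub> (2 ^ k :: nat) = Affine x' y' \<and>
    r \<in> odd_Z2 \<and> 4 ^ k * x' = x * r"
  using assms
proof (induction k arbitrary: x y)
  case 0
  then show ?case
    by (auto intro!: odd_Z2I[of 0])
next
  case (Suc k)
  note P = Suc.prems(1)
  obtain x\<^sub>2 y\<^sub>2 r where 2: "ec_add A (Affine x y) (Affine x y) = Affine x\<^sub>2 y\<^sub>2"
      "near_Infinity A B x\<^sub>2" "r \<in> odd_Z2" "4 * x\<^sub>2 = x * r"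
    using ec_double_near_Infinity(2)[OF Suc.prems] by blast
  have "Affine x\<^sub>2 y\<^sub>2 \<in> ec_points A B"
    using ec_add_closed[OF P P] unfolding 2(1) .
  from Suc.IH[OF this 2(2)] obtain x' y' r' where
    IH: "Affine x\<^sub>2 y\<^sub>2 [^]\<^bsub>ec_group A B\<^esub> (2 ^ k :: nat) = Affine x' y'"
      "r' \<in> odd_Z2" "4 ^ k * x' = x\<^sub>2 * r'"
    by blast
  have "Affine x y [^]\<^bsub>ec_group A B\<^esub> (2 ^ Suc k :: nat) = Affine x' y'"
    using ec_pow_double[OF P ec_double_near_Infinity(1)[OF Suc.prems], of "2 ^ k"]
    by (simp add: 2 IH)
  moreover have "4 ^ Suc k * x' = x * (r * r')"
  proof -
    have "4 ^ Suc k * x' = 4 * (4 ^ k * x')"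
      by simp
    also have "\<dots> = (4 * x\<^sub>2) * r'"
      by (simp only: IH(3) mult.assoc)
    finally show ?thesis
      by (simp only: 2(4) mult.assoc)
  qed
  ultimately show ?case
    using odd_Z2_mult[OF 2(3) IH(2)] by blast
qed

lemma near_Infinity_infinite_order:
  fixes n :: nat
  assumes P: "Affine x y \<in> ec_points A B" and near: "near_Infinity A B x" and "n > 0"
  shows "Affine x y [^]\<^bsub>ec_group A B\<^esub> n \<noteq> Infinity"
proof
  assume n: "Affine x y [^]\<^bsub>ec_group A B\<^esub> n = Infinity"
  \<comment> \<open>Pigeonhole: the residues of the powers of 2 modulo \<open>n\<close> repeat, so
    two of the multiples coincide.\<close>
  let ?f = "\<lambda>k::nat. 2 ^ k mod n"
  have "finite (range ?f)"
    by (rule finite_subset[of _ "{..<n}"]) (use \<open>n > 0\<close> in auto)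
  then have "\<not> inj ?f"
    using finite_imageD[of ?f UNIV] infinite_UNIV_nat by blast
  then obtain i j where "i < j" and ij: "?f i = ?f j"
    using linorder_injI[of ?f] by blast
  obtain x\<^sub>1 y\<^sub>1 r where 1: "Affine x y [^]\<^bsub>ec_group A B\<^esub> (2 ^ i :: nat) = Affine x\<^sub>1 y\<^sub>1"
      "r \<in> odd_Z2" "4 ^ i * x\<^sub>1 = x * r"
    using ec_pow_two_power_near_Infinity[OF P near, of i] by (elim exE conjE) (rule that)
  obtain x\<^sub>2 y\<^sub>2 q where 2: "Affine x y [^]\<^bsub>ec_group A B\<^esub> (2 ^ j :: nat) = Affine x\<^sub>2 y\<^sub>2"
      "q \<in> odd_Z2" "4 ^ j * x\<^sub>2 = x * q"
    using ec_pow_two_power_near_Infinity[OF P near, of j] by (elim exE conjE) (rule that)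
  have "Affine x y [^]\<^bsub>ec_group A B\<^esub> (2 ^ i :: nat) = Affine x y [^]\<^bsub>ec_group A B\<^esub> (2 ^ j :: nat)"
    using ec_pow_mod[OF n, of "2 ^ i"] ec_pow_mod[OF n, of "2 ^ j"] ij by simp
  then have "x\<^sub>1 = x\<^sub>2"
    using 1 2 by simp
  obtain d where d: "j = i + Suc d"
    using \<open>i < j\<close> less_iff_Suc_add by auto
  \<comment> \<open>Comparing the two formulas for the common x-coordinate turns the unit
    \<open>q\<close> into \<open>4 ^ Suc d * r\<close>, which is even.\<close>
  have "x * q = 4 ^ j * x\<^sub>1"
    using 2(3) \<open>x\<^sub>1 = x\<^sub>2\<close> by simp
  also have "\<dots> = 2 * (2 * 4 ^ d) * (4 ^ i * x\<^sub>1)"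
    by (simp add: d power_add)
  also have "\<dots> = x * (2 * (2 * 4 ^ d * r))"
    unfolding 1(3) by simp
  finally have "x * q = x * (2 * (2 * 4 ^ d * r))" .
  moreover have "x \<noteq> 0"
    using near unfolding near_Infinity_def by blast
  ultimately have "q = 2 * (2 * 4 ^ d * r)"
    by simp
  moreover have "2 * 4 ^ d * r \<in> Z2"
    by (intro Z2_intros odd_Z2_imp_Z2 1)
  ultimately show False
    using odd_Z2_not_double[OF 2(2)] by blast
qed

section \<open>The multiples of \<open>(-1, s)\<close>\<close>

text \<open>The 2-adic valuation of \<open>s\<close> is nonnegative, -1, or at most -2, according to
  whether the reduced denominator is odd, twice odd, or divisible by 4.\<close>

lemma rat_two_adic_cases:
  fixes s :: rat
  obtains "s \<in> Z2" | "2 * s \<in> odd_Z2" | "s \<noteq> 0" "1 / (4 * s) \<in> Z2"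
proof -
  obtain m n where s: "s = of_int m / of_int n" and "n > 0" "coprime m n"
    by (cases s) (auto simp: Fract_of_int_quotient)
  show thesis
  proof (cases "even n")
    case False
    then show thesis
      using that(1) Z2I s by simp
  next
    case True
    with \<open>coprime m n\<close> have "odd m"
      by (metis coprime_common_divisor odd_one)
    obtain k where k: "n = 2 * k"
      using True by blast
    show thesis
    proof (cases "even k")
      case False
      have "2 * s = of_int m / of_int k"
        by (simp add: s k)
      then show thesis
        using that(2) odd_Z2_quotient[OF \<open>odd m\<close> False] by simp
    next
      case True
      then obtain l where l: "n = 4 * l"
        using k by auto
      have "m \<noteq> 0"
        using \<open>odd m\<close> by auto
      then have "s \<noteq> 0" "1 / (4 * s) = of_int l / of_int m"
        using \<open>n > 0\<close> by (auto simp: s l)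
      then show thesis
        using that(3) Z2I[OF \<open>odd m\<close>] by simp
    qed
  qed
qed

text \<open>In terms of \<open>z = 1 / x\<close>, large at 2 means that \<open>z\<close> is even.
  Then \<open>A / x ^ 2 / 2 = 2 * A * (z / 2) ^ 2\<close> is integral; \<open>B\<close> may have
  denominators, so its condition stays explicit.\<close>

lemma near_InfinityI:
  assumes "z * x = 1" "z / 2 \<in> Z2" "B * z ^ 3 / 2 \<in> Z2" "A \<in> Z2"
  shows "near_Infinity A B x"
proof -
  have "x \<noteq> 0"
    using assms(1) by auto
  then have z: "z = 1 / x"
    using assms(1) by (simp add: eq_divide_eq)
  have "A * (2 * (z / 2) ^ 2) \<in> Z2"
    by (intro Z2_intros assms)
  moreover have "A / x ^ 2 / 2 = A * (2 * (z / 2) ^ 2)" "B / x ^ 3 / 2 = B * z ^ 3 / 2"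
    by (simp_all add: z power_divide)
  ultimately show ?thesis
    using assms(3) \<open>x \<noteq> 0\<close> unfolding near_Infinity_def by metis
qed

text \<open>With \<open>Q = (-1, s)\<close> the point is \<open>4Q\<close> if \<open>s\<close> is integral at 2, \<open>5Q\<close> if its
  denominator is twice an odd number, and \<open>3Q\<close> otherwise.\<close>

lemma exists_point_near_Infinity:
  fixes s :: rat
  assumes "s \<noteq> 0"
  shows "\<exists>x y. Affine x y \<in> ec_points (- 3) (s ^ 2 - 2) \<and> near_Infinity (- 3) (s ^ 2 - 2) x"
proof -
  have m3: "- 3 \<in> Z2"
    by (intro Z2_intros)
  show ?thesis
  proof (cases s rule: rat_two_adic_cases)
    case 1
    \<comment> \<open>The tangent at Q is horizontal, so 2Q = \<open>(2, - s)\<close>. The tangent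
      there has slope \<open>- t\<close>, and doubling gives 4Q with first coordinate
      \<open>x\<close>.\<close>
    define t where "t = 9 / (2 * s)"
    define x where "x = t ^ 2 - 4"
    define u where "u = 81 - 16 * s ^ 2"
    define z where "z = 4 * s ^ 2 * inverse u"
    have t: "2 * s * t = 9"
      using assms by (simp add: t_def)
    have u: "u \<in> odd_Z2"
      by (rule odd_Z2I[of "40 - 8 * s ^ 2"]) (auto simp: u_def intro!: Z2_intros 1)
    have "4 * s ^ 2 * x = (2 * s * t) ^ 2 - 16 * s ^ 2"
      unfolding x_def by algebra
    then have "4 * s ^ 2 * x = u"
      unfolding t u_def by simp
    then have "z * x = 1"
      using odd_Z2_nonzero[OF u] by (simp add: z_def field_simps)
    moreover have iu: "inverse u \<in> Z2"
      by (intro odd_Z2_imp_Z2 odd_Z2_inverse u)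
    have z2: "z / 2 = 2 * s ^ 2 * inverse u"
      by (simp add: z_def)
    then have "z / 2 \<in> Z2"
      unfolding z2 by (intro Z2_intros 1 iu)
    moreover from this have "4 * (s ^ 2 - 2) * (z / 2) ^ 3 \<in> Z2"
      by (intro Z2_intros 1)
    moreover have "(s ^ 2 - 2) * z ^ 3 / 2 = 4 * (s ^ 2 - 2) * (z / 2) ^ 3"
      by (simp add: power_divide)
    ultimately have "near_Infinity (- 3) (s ^ 2 - 2) x"
      using near_InfinityI[of z x] m3 by simp
    moreover have "(t * (x - 2) + s) ^ 2 = t ^ 2 * (x - 2) ^ 2 + 2 * s * t * (x - 2) + s ^ 2"
      by algebra
    then have "(t * (x - 2) + s) ^ 2 = x ^ 3 + (- 3) * x + (s ^ 2 - 2)"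
      unfolding t x_def by algebra
    ultimately show ?thesis
      unfolding Affine_in_ec_points by blast
  next
    case 2
    then obtain r where r: "r \<in> Z2" and s: "2 * s = 1 + 2 * r"
      unfolding odd_Z2_def by blast
    \<comment> \<open>2Q and 3Q have x-coordinates 2 and \<open>4 * s ^ 2 / 9 - 1\<close>, which
      differ by \<open>2 * v / 9\<close>. The chord through them has the slope \<open>m\<close>
      below and leads to 5Q.\<close>
    define v where "v = 1 + 2 * (r ^ 2 + r - 7)"
    have v: "v \<in> odd_Z2"
      unfolding v_def by (rule odd_Z2I[OF _ refl]) (intro Z2_intros r)
    have vs: "2 * v = 4 * s ^ 2 - 27"
      using s unfolding v_def by algebra
    define m where "m = 4 * s ^ 3 * inverse (3 * v)"
    have m: "3 * v * m = 4 * s ^ 3"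
      using odd_Z2_nonzero[OF v] by (simp add: m_def)
    define x where "x = m ^ 2 - 2 - (4 * s ^ 2 / 9 - 1)"
    \<comment> \<open>Numerator of \<open>x\<close> over \<open>36 * v ^ 2\<close>: the sixth powers
      cancel in \<open>(2 * s) ^ 6 - ((2 * s) ^ 2 - 27) ^ 2 * ((2 * s) ^ 2 + 9)\<close>.\<close>
    define N where "N = 45 * (2 * s) ^ 4 - 243 * (2 * s) ^ 2 - 6561"
    have N: "N \<in> odd_Z2"
    proof (rule odd_Z2I)
      \<comment> \<open>Chosen so that \<open>(2 * s) ^ 2 = 1 + 2 * ?q\<close>.\<close>
      let ?q = "2 * r ^ 2 + 2 * r"
      show "90 * ?q * (?q + 1) - 243 * ?q - 3380 \<in> Z2"
        by (intro Z2_intros r)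
      show "N = 1 + 2 * (90 * ?q * (?q + 1) - 243 * ?q - 3380)"
        unfolding N_def s by algebra
    qed
    have "36 * v ^ 2 * x = N"
    proof -
      have "36 * v ^ 2 * x = 4 * (3 * v * m) ^ 2 - (2 * v) ^ 2 * (4 * s ^ 2 + 9)"
        unfolding x_def by (simp add: field_simps power2_eq_square)
      then show ?thesis
        unfolding m vs N_def by algebra
    qed
    define z where "z = 36 * v ^ 2 * inverse N"
    have "z * x = 1"
      using \<open>36 * v ^ 2 * x = N\<close> odd_Z2_nonzero[OF N] by (simp add: z_def field_simps)
    moreover have iN: "inverse N \<in> Z2" and v': "v \<in> Z2"
      by (intro odd_Z2_imp_Z2 odd_Z2_inverse N v)+
    have z2: "z / 2 = 18 * v ^ 2 * inverse N"
      by (simp add: z_def)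
    then have "z / 2 \<in> Z2"
      unfolding z2 by (intro Z2_intros iN v')
    moreover from this have "((2 * s) ^ 2 - 8) * (z / 2) ^ 3 \<in> Z2"
      by (intro Z2_mult Z2_diff Z2_power odd_Z2_imp_Z2[OF 2]) simp_all
    \<comment> \<open>\<open>z ^ 3 / 2 = 4 * (z / 2) ^ 3\<close>, and the 4 clears the denominator
      of \<open>s ^ 2\<close>.\<close>
    moreover have "(s ^ 2 - 2) * z ^ 3 / 2 = ((2 * s) ^ 2 - 8) * (z / 2) ^ 3"
      by (simp add: power_divide field_simps)
    ultimately have "near_Infinity (- 3) (s ^ 2 - 2) x"
      using near_InfinityI[of z x] m3 by simp
    moreover have "(m * (2 - x) - (- s)) ^ 2 = x ^ 3 + (- 3) * x + (s ^ 2 - 2)"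
    proof (rule third_point_on_curve)
      show "m ^ 2 * ((4 * s ^ 2 / 9 - 1) - 2) + 2 * (- s) * m =
          2 ^ 2 + 2 * (4 * s ^ 2 / 9 - 1) + (4 * s ^ 2 / 9 - 1) ^ 2 + - 3"
      proof -
        \<comment> \<open>Eliminate \<open>m\<close> by alternately replacing
          \<open>4 * s ^ 2 - 27\<close> by \<open>2 * v\<close> and \<open>3 * v * m\<close> by
          \<open>4 * s ^ 3\<close>.\<close>
        have "81 * (m ^ 2 * ((4 * s ^ 2 / 9 - 1) - 2) + 2 * (- s) * m) =
            9 * m ^ 2 * (4 * s ^ 2 - 27) - 162 * s * m"
          by (simp add: field_simps)
        also have "\<dots> = 6 * m * (3 * v * m) - 162 * s * m"
          unfolding vs[symmetric] by algebra
        also have "\<dots> = 6 * s * m * (4 * s ^ 2 - 27)"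
          unfolding m by algebra
        also have "\<dots> = 4 * s * (3 * v * m)"
          unfolding vs[symmetric] by algebra
        also have "\<dots> = 16 * s ^ 4"
          unfolding m by algebra
        also have "\<dots> = 81 * (2 ^ 2 + 2 * (4 * s ^ 2 / 9 - 1) + (4 * s ^ 2 / 9 - 1) ^ 2 + - 3)"
          by (simp add: field_simps eval_nat_numeral)
        finally show ?thesis
          by simp
      qed
    qed (simp_all add: x_def)
    ultimately show ?thesis
      unfolding Affine_in_ec_points by blast
  next
    case 3
    define \<rho> where "\<rho> = 1 / (4 * s)"
    have \<rho>: "\<rho> \<in> Z2" "4 * s * \<rho> = 1"
      using 3 by (simp_all add: \<rho>_def)
    \<comment> \<open>First coordinate of 3Q: the chord from \<open>(-1, s)\<close> to
      \<open>(2, - s)\<close> has slope \<open>- 2 * s / 3\<close>.\<close>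
    define x where "x = 4 * s ^ 2 / 9 - 1"
    define u where "u = 1 - 36 * \<rho> ^ 2"
    have u: "u \<in> odd_Z2"
      by (rule odd_Z2I[of "- (18 * \<rho> ^ 2)"]) (auto simp: u_def intro!: Z2_intros \<rho>)
    then have iu: "inverse u \<in> Z2"
      by (intro odd_Z2_imp_Z2 odd_Z2_inverse)
    define z where "z = 36 * \<rho> ^ 2 * inverse u"
    have "36 * \<rho> ^ 2 * x = u"
    proof -
      have "(4 * s * \<rho>) ^ 2 - 36 * \<rho> ^ 2 = 36 * \<rho> ^ 2 * x"
        unfolding x_def by (simp add: power_mult_distrib algebra_simps)
      then show ?thesis
        unfolding \<rho> u_def by simp
    qed
    then have "z * x = 1"
      using odd_Z2_nonzero[OF u] by (simp add: z_def field_simps)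
    moreover have "z / 2 = 18 * \<rho> ^ 2 * inverse u"
      by (simp add: z_def)
    then have "z / 2 \<in> Z2"
      by (simp only:) (intro Z2_intros \<rho> iu)
    \<comment> \<open>Two of the six factors \<rho> in \<open>z ^ 3\<close> absorb
      \<open>s ^ 2\<close>, as \<open>s ^ 2 * \<rho> ^ 2 = 1 / 16\<close>; this 16 divides
      \<open>36 ^ 2\<close>.\<close>
    moreover have "(s ^ 2 - 2) * z ^ 3 / 2 =
        (18 * 36 ^ 2) * (((4 * s * \<rho>) ^ 2 / 16 - 2 * \<rho> ^ 2) * \<rho> ^ 4 * inverse u ^ 3)"
      unfolding z_def by algebra
    then have "(s ^ 2 - 2) * z ^ 3 / 2 = (81 * 18 - 36 ^ 3 * \<rho> ^ 2) * \<rho> ^ 4 * inverse u ^ 3"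
      unfolding \<rho>(2) by (simp add: algebra_simps)
    then have "(s ^ 2 - 2) * z ^ 3 / 2 \<in> Z2"
      by (simp only:) (intro Z2_intros \<rho> iu)
    ultimately have "near_Infinity (- 3) (s ^ 2 - 2) x"
      using near_InfinityI[of z x] m3 by simp
    moreover have "(s * (8 * s ^ 2 / 27 - 1)) ^ 2 = x ^ 3 + (- 3) * x + (s ^ 2 - 2)"
      unfolding x_def by (simp add: field_simps eval_nat_numeral)
    ultimately show ?thesis
      unfolding Affine_in_ec_points by blast
  qed
qed

section \<open>Transfer to the original curve by scaling\<close>

lemma ec_points_scale:
  assumes "Affine x y \<in> ec_points A B"
  shows "Affine (u ^ 2 * x) (u ^ 3 * y) \<in> ec_points (u ^ 4 * A) (u ^ 6 * B)"
  using assms unfolding Affine_in_ec_points by algebra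

lemma near_Infinity_scale:
  assumes "near_Infinity A B x" "u \<noteq> 0"
  shows "near_Infinity (u ^ 4 * A) (u ^ 6 * B) (u ^ 2 * x)"
proof -
  have "u ^ 4 * A / (u ^ 2 * x) ^ 2 = A / x ^ 2" "u ^ 6 * B / (u ^ 2 * x) ^ 3 = B / x ^ 3"
    using \<open>u \<noteq> 0\<close> by (simp_all add: power_mult_distrib flip: power_mult)
  with assms show ?thesis
    by (simp add: near_Infinity_def)
qed

theorem theorem2p4:
  fixes a b c :: rat
  assumes "a * b * c \<noteq> 0"
    and "2 * a * c - b ^ 2 \<noteq> 0"
    and "4 * a * c - b ^ 2 \<noteq> 0"
  shows "is_elliptic_curve (- 3 * a ^ 4 * c ^ 4)
           (a ^ 4 * c ^ 4 * (2 * a ^ 2 * c ^ 2 - 4 * a * b ^ 2 * c + b ^ 4))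
       \<and> ec_rank (- 3 * a ^ 4 * c ^ 4)
           (a ^ 4 * c ^ 4 * (2 * a ^ 2 * c ^ 2 - 4 * a * b ^ 2 * c + b ^ 4)) > 0"
    (is "is_elliptic_curve ?A ?B \<and> _")
proof -
  define u where "u = a * c"
  define s where "s = b ^ 2 / u - 2"
  have u: "u \<noteq> 0"
    using assms(1) by (auto simp: u_def)
  have us: "u * s = b ^ 2 - 2 * u"
    using u by (simp add: s_def right_diff_distrib)
  have A: "?A = u ^ 4 * (- 3)"
    unfolding u_def by algebra
  have "?B = u ^ 4 * ((b ^ 2 - 2 * u) ^ 2 - 2 * u ^ 2)"
    unfolding u_def by algebra
  then have B: "?B = u ^ 6 * (s ^ 2 - 2)"
    unfolding us[symmetric] by algebra
  have "s \<noteq> 0"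
    using us assms(2) by (auto simp: u_def)
  then obtain x y where xy: "Affine x y \<in> ec_points (- 3) (s ^ 2 - 2)"
      "near_Infinity (- 3) (s ^ 2 - 2) x"
    using exists_point_near_Infinity by blast
  \<comment> \<open>The discriminant is a nonzero multiple of
    \<open>s ^ 2 * (s - 2) * (s + 2)\<close>. Times \<open>u\<close>, the factors
    \<open>s + 2\<close>, \<open>s\<close>, \<open>s - 2\<close> are \<open>b ^ 2\<close>,
    \<open>b ^ 2 - 2 * a * c\<close>, \<open>b ^ 2 - 4 * a * c\<close>, nonzero by the three
    assumptions.\<close>
  have "s \<noteq> - 2"
    using us assms(1) by auto
  moreover have "s \<noteq> 2"
    using us assms(3) by (auto simp: u_def)
  moreover have "ec_discriminant (u ^ 4 * (- 3)) (u ^ 6 * E) = - 432 * u ^ 12 * (E ^ 2 - 4)" for E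
    by (simp add: ec_discriminant_def power_mult_distrib algebra_simps flip: power_mult)
  moreover have "(s ^ 2 - 2) ^ 2 - 4 = s ^ 2 * ((s - 2) * (s + 2))"
    by algebra
  ultimately have "is_elliptic_curve ?A ?B"
    unfolding A B is_elliptic_curve_def using u \<open>s \<noteq> 0\<close> by (simp add: add_eq_0_iff2)
  moreover have "ec_rank ?A ?B > 0"
    unfolding ec_rank_def A B
    using ec_group_rank_pos[OF ec_points_scale[OF xy(1)]]
      near_Infinity_infinite_order[OF ec_points_scale[OF xy(1)] near_Infinity_scale[OF xy(2) u]]
    by blast
  ultimately show ?thesis
    by blast
qed

end
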